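(* Let $B$ be a (finite or infinite) Blaschke product with zeros $\{z_j\}_{j\ge1}\subset\mathbb{D}$ and assume that there exists a point $\zeta\in\partial\mathbb{D}$ such that $\operatorname{dist}(\zeta,\{z_j\}_{j\ge1})>0$ and, moreover, $$|B'(\zeta)|\,\operatorname{dist}(\zeta,\{z_j\}_{j\ge1})\ge\delta>0$$ for some $0<\delta\le1$. Then for $z_0=\Big(1-\frac{\delta}{8|B'(\zeta)|}\Big)\zeta$ we have $$|B'(z_0)|(1-|z_0|^2)\ge 0.07\,\delta .$$
   Context: $\mathbb{D}=\{z\in\mathbb{C}:|z|<1\}$. The Blaschke product with zeros $\{z_j\}_{j\ge1}$ (a nonempty finite or infinite sequence in $\mathbb{D}$, repeated according to multiplicity, with $\sum_j(1-|z_j|)<\infty$) is $$B(z)=\prod_{j\ge1}\frac{|z_j|}{z_j}\,\frac{z_j-z}{1-\overline{z_j}z},$$ where a factor with $z_j=0$ is understood as $z$. Since $\zeta$ has positive distance from the zeros, $B$ extends analytically to a neighbourhood of $\zeta$, and $B'(\zeta)$ denotes the derivative of this extension. *)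

theory Defs
  imports "HOL-Complex_Analysis.Complex_Analysis" "HOL-Library.Extended_Nat"
begin

text \<open>
  A finite or infinite sequence of zeros is given by a function \<open>a :: nat \<Rightarrow> complex\<close> together
  with its length \<open>N :: enat\<close>; only the values \<open>a j\<close> with \<open>enat j < N\<close> are relevant.
\<close>

definition blaschke_index :: "enat \<Rightarrow> nat set" where
  "blaschke_index N = {j. enat j < N}"

definition blaschke_sequence :: "enat \<Rightarrow> (nat \<Rightarrow> complex) \<Rightarrow> bool" where
  "blaschke_sequence N a \<longleftrightarrow>
     0 < N \<and>
     (\<forall>j\<in>blaschke_index N. norm (a j) < 1) \<and>
     (\<lambda>j. 1 - norm (a j)) summable_on blaschke_index N"

definition blaschke_factor :: "complex \<Rightarrow> complex \<Rightarrow> complex" where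
  "blaschke_factor a z =
     (if a = 0 then z
      else complex_of_real (norm a) / a * ((a - z) / (1 - cnj a * z)))"

text \<open>
  The product is only meant for \<open>norm z < 1\<close>, where it converges for every Blaschke sequence;
  elsewhere the value may be arbitrary.
\<close>

definition blaschke_product :: "enat \<Rightarrow> (nat \<Rightarrow> complex) \<Rightarrow> complex \<Rightarrow> complex" where
  "blaschke_product N a z =
     (\<Prod>j. if j \<in> blaschke_index N then blaschke_factor (a j) z else 1)"

text \<open>
  The derivative at a boundary point \<open>\<zeta>\<close> of the unit disc of the analytic extension of
  \<open>f\<close> from the disc to a neighbourhood of \<open>\<zeta>\<close>. It uses the values of \<open>f\<close> inside the disc only.
  By the identity theorem it does not depend on the extension, so the description is
  meaningful whenever an extension exists.
\<close>

definition boundary_deriv :: "(complex \<Rightarrow> complex) \<Rightarrow> complex \<Rightarrow> complex" where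
  "boundary_deriv f \<zeta> =
     (THE d. \<exists>F U. open U \<and> \<zeta> \<in> U \<and> F holomorphic_on U \<and>
        (\<forall>w\<in>U \<inter> ball 0 1. F w = f w) \<and> d = deriv F \<zeta>)"

end

theory Submission
  imports Defs
begin

text \<open>
  Write \<open>d\<close> for the distance from \<open>\<zeta>\<close> to the zeros and \<open>M = norm (B' \<zeta>)\<close>. On the disc of radius
  \<open>d / 2\<close> around \<open>\<zeta>\<close> the denominators \<open>1 - cnj a * z\<close> stay away from \<open>0\<close>, so the product
  converges uniformly there, extends \<open>B\<close> analytically without zeros, and
  \<open>B' z / B z = (\<Sum>j. (1 - |a\<^sub>j|\<^sup>2) / ((z - a\<^sub>j) (1 - cnj a\<^sub>j * z)))\<close>. At \<open>z = \<zeta>\<close>, where \<open>|B| = 1\<close>,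
  this says \<open>M = (\<Sum>j. m\<^sub>j)\<close> with \<open>m\<^sub>j = (1 - |a\<^sub>j|\<^sup>2) / |\<zeta> - a\<^sub>j|\<^sup>2\<close>.

  Put \<open>h = \<delta> / (8 M)\<close>, so that \<open>z0 = (1 - h) \<zeta>\<close> and \<open>h \<le> d / 8 \<le> |\<zeta> - a\<^sub>j| / 8\<close>. Moving from \<open>\<zeta>\<close> to
  \<open>z0\<close> therefore changes \<open>\<zeta> - a\<^sub>j\<close> and \<open>1 - cnj a\<^sub>j * \<zeta>\<close> by at most one eighth of their size, and
  two estimates follow.
  \<^item> Each term of \<open>\<zeta> B' z0 / B z0\<close> has real part at least \<open>64/81 m\<^sub>j\<close>
    (\<open>Re_logderiv_blaschke_factor_near_circle\<close>). All terms point to the right, so there is no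
    cancellation and \<open>|B' z0| \<ge> 64/81 M |B z0|\<close>.
  \<^item> Since \<open>1 - |b|\<^sup>2 = (1 - |a|\<^sup>2) (1 - |z|\<^sup>2) / |1 - cnj a * z|\<^sup>2\<close> for each factor \<open>b\<close>, the inequality
    \<open>\<Prod>(1 - x\<^sub>j) \<ge> 1 - \<Sum>x\<^sub>j\<close> gives \<open>|B z0|\<^sup>2 \<ge> 1 - 64/49 h (2 - h) M \<ge> 1 - 16/49 \<ge> (4/5)\<^sup>2\<close>.

  As \<open>1 - |z0|\<^sup>2 = h (2 - h)\<close> and \<open>h \<le> 1/4\<close>, these combine to
  \<open>|B' z0| (1 - |z0|\<^sup>2) \<ge> 4/5 * 64/81 * 7/32 * \<delta> > 0.13 \<delta>\<close>.
\<close>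

section \<open>A single Blaschke factor\<close>

lemma cnj_mult_self_circle: "norm \<zeta> = 1 \<Longrightarrow> cnj \<zeta> * \<zeta> = 1"
  using complex_norm_square[of \<zeta>] by (simp add: mult.commute)

lemma norm_one_minus_cnj_mult:
  fixes a \<zeta> :: complex
  assumes "norm \<zeta> = 1"
  shows "norm (1 - cnj a * \<zeta>) = norm (\<zeta> - a)"
proof -
  have "cnj \<zeta> * \<zeta> = 1"
    using assms by (rule cnj_mult_self_circle)
  then have "1 - cnj a * \<zeta> = cnj (\<zeta> - a) * \<zeta>"
    by (simp add: algebra_simps)
  then show ?thesis
    using assms by (metis complex_mod_cnj mult.right_neutral norm_mult)
qed

lemma norm_blaschke_factor_minus_1_le:
  assumes "norm a < 1" "0 < c" "c \<le> norm (1 - cnj a * z)"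
  shows "norm (blaschke_factor a z - 1) \<le> (1 - norm a) * (1 + norm z) / c"
proof -
  have *: "norm (blaschke_factor a z - 1) \<le> (1 - norm a) * (1 + norm z) / norm (1 - cnj a * z)"
  proof (cases "a = 0")
    case True
    then show ?thesis
      using norm_triangle_ineq4[of z 1] by (simp add: blaschke_factor_def)
  next
    case False
    have nz: "1 - cnj a * z \<noteq> 0" using assms by auto
    have sq: "of_real (norm a) * of_real (norm a) = a * cnj a"
      using complex_norm_square[of a] by (simp add: power2_eq_square)
    have "blaschke_factor a z - 1 = 
      (of_real (norm a) * (a - z) - a * (1 - cnj a * z)) / (a * (1 - cnj a * z))"
      using False nz by (simp add: blaschke_factor_def field_simps)
    also have "of_real (norm a) * (a - z) - a * (1 - cnj a * z) =
        of_real (norm a) * (a - z) - a + (a * cnj a) * z"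
      by (simp add: algebra_simps)
    also have "\<dots> = - (of_real (1 - norm a) * (a + of_real (norm a) * z))"
      unfolding sq[symmetric] by (simp add: algebra_simps)
    finally have "norm (blaschke_factor a z - 1) =
        (1 - norm a) * norm (a + of_real (norm a) * z) / (norm a * norm (1 - cnj a * z))"
      using assms by (simp add: norm_divide norm_mult del: of_real_diff)
    also have "\<dots> \<le> (1 - norm a) * (norm a * (1 + norm z)) / (norm a * norm (1 - cnj a * z))"
      using assms norm_triangle_ineq[of a "of_real (norm a) * z"]
      by (intro divide_right_mono mult_left_mono) (auto simp: norm_mult algebra_simps)
    finally show ?thesis using False by simp
  qed
  also have "\<dots> \<le> (1 - norm a) * (1 + norm z) / c"
    using assms by (intro divide_left_mono) (auto intro!: mult_pos_pos)
  finally show ?thesis .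
qed

lemma holomorphic_on_blaschke_factor:
  assumes "\<And>z. z \<in> A \<Longrightarrow> 1 - cnj a * z \<noteq> 0"
  shows "blaschke_factor a holomorphic_on A"
proof (cases "a = 0")
  case True
  then have "blaschke_factor a = (\<lambda>z. z)" by (auto simp: blaschke_factor_def)
  then show ?thesis by simp
next
  case False
  then have "blaschke_factor a =
      (\<lambda>z. complex_of_real (norm a) / a * ((a - z) / (1 - cnj a * z)))"
    by (auto simp: blaschke_factor_def)
  then show ?thesis using assms False by (auto intro!: holomorphic_intros)
qed

lemma blaschke_factor_eq_0_iff:
  assumes "1 - cnj a * z \<noteq> 0"
  shows "blaschke_factor a z = 0 \<longleftrightarrow> z = a"
  using assms by (auto simp: blaschke_factor_def)

lemma logderiv_blaschke_factor:
  assumes "1 - cnj a * z \<noteq> 0" "z \<noteq> a"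
  shows "deriv (blaschke_factor a) z / blaschke_factor a z =
    of_real (1 - (norm a)\<^sup>2) / ((z - a) * (1 - cnj a * z))"
proof (cases "a = 0")
  case True
  then have "blaschke_factor a = (\<lambda>z. z)" by (auto simp: blaschke_factor_def)
  then show ?thesis using True by simp
next
  case False
  then have eq: "blaschke_factor a =
      (\<lambda>z. complex_of_real (norm a) / a * ((a - z) / (1 - cnj a * z)))"
    by (auto simp: blaschke_factor_def)
  have sq: "of_real ((norm a)\<^sup>2) = a * cnj a"
    by (rule complex_norm_square)
  have "(blaschke_factor a has_field_derivative
      complex_of_real (norm a) / a * ((- (1 - cnj a * z) + (a - z) * cnj a) / (1 - cnj a * z)\<^sup>2)) (at z)"
    unfolding eq
  proof (rule DERIV_cmult)
    show "((\<lambda>z. (a - z) / (1 - cnj a * z)) has_field_derivative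
        (- (1 - cnj a * z) + (a - z) * cnj a) / (1 - cnj a * z)\<^sup>2) (at z)"
      using assms by (auto intro!: derivative_eq_intros simp: power2_eq_square)
  qed
  then have d: "deriv (blaschke_factor a) z = complex_of_real (norm a) / a *
      ((- (1 - cnj a * z) + (a - z) * cnj a) / (1 - cnj a * z)\<^sup>2)"
    by (rule DERIV_imp_deriv)
  have "deriv (blaschke_factor a) z / blaschke_factor a z =
      (- (1 - cnj a * z) + (a - z) * cnj a) / (1 - cnj a * z)\<^sup>2 / ((a - z) / (1 - cnj a * z))"
    using False unfolding d by (simp add: eq)
  also have "\<dots> = (- (1 - cnj a * z) + (a - z) * cnj a) / ((a - z) * (1 - cnj a * z))"
    using assms by (simp add: power2_eq_square)
  also have "- (1 - cnj a * z) + (a - z) * cnj a = - of_real (1 - (norm a)\<^sup>2)"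
    using sq by (simp add: algebra_simps)
  also have "- of_real (1 - (norm a)\<^sup>2) / ((a - z) * (1 - cnj a * z)) =
      of_real (1 - (norm a)\<^sup>2) / ((z - a) * (1 - cnj a * z))"
    using nonzero_minus_divide_divide[of "(z - a) * (1 - cnj a * z)"
        "of_real (1 - (norm a)\<^sup>2)"] assms
    by (simp only: minus_mult_left minus_diff_eq) simp
  finally show ?thesis .
qed

lemma one_minus_norm_blaschke_factor_sq:
  assumes "1 - cnj a * z \<noteq> 0"
  shows "1 - (norm (blaschke_factor a z))\<^sup>2 =
    (1 - (norm a)\<^sup>2) * (1 - (norm z)\<^sup>2) / (norm (1 - cnj a * z))\<^sup>2"
proof -
  have id: "(norm (1 - cnj a * z))\<^sup>2 - (norm (a - z))\<^sup>2 = (1 - (norm a)\<^sup>2) * (1 - (norm z)\<^sup>2)"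
    unfolding cmod_power2 by (simp add: power2_eq_square algebra_simps)
  have "norm (blaschke_factor a z) = norm (a - z) / norm (1 - cnj a * z)"
    by (simp add: blaschke_factor_def norm_divide norm_mult)
  then show ?thesis
    using assms by (simp add: power_divide diff_divide_distrib flip: id)
qed

section \<open>Moving radially inwards from a boundary point\<close>

text \<open>Inversion maps a disc around \<open>1\<close> that omits \<open>0\<close> to a disc whose leftmost point is \<open>1 / (1 + r)\<close>.\<close>

lemma Re_inverse_ge:
  assumes "norm (q - 1) \<le> r" "r < 1"
  shows "Re (1 / q) \<ge> 1 / (1 + r)"
proof -
  have r: "r \<ge> 0" using assms norm_ge_zero order_trans by blast
  have q: "q \<noteq> 0" using assms by auto
  have "(norm (q - 1))\<^sup>2 \<le> r\<^sup>2"
    using assms by (intro power_mono) auto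
  then have 1: "(norm q)\<^sup>2 \<le> r\<^sup>2 - 1 + 2 * Re q"
    unfolding cmod_power2 by (simp add: power2_eq_square algebra_simps)
  have "Re q \<le> 1 + r"
    using complex_Re_le_cmod[of "q - 1"] assms by simp
  then have "(1 - r) * Re q \<le> (1 - r) * (1 + r)"
    using assms by (intro mult_left_mono) auto
  then have "(norm q)\<^sup>2 \<le> (1 + r) * Re q"
    using 1 by (simp add: power2_eq_square algebra_simps)
  then show ?thesis
    using q r by (simp add: Re_divide flip: cmod_power2) (simp add: field_simps)
qed

text \<open>
  The term is the boundary value \<open>(1 - |a|\<^sup>2) / |\<zeta> - a|\<^sup>2\<close> divided by a factor \<open>(1 + u) (1 + v)\<close> with
  \<open>|u|, |v| \<le> 1/8\<close>, which lies in the disc of radius \<open>(9/8)\<^sup>2 - 1 = 17/64\<close> around \<open>1\<close>.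
\<close>

lemma Re_logderiv_blaschke_factor_near_circle:
  fixes a \<zeta> :: complex and h :: real
  assumes "norm \<zeta> = 1" "norm a < 1" "0 \<le> h" "8 * h \<le> norm (\<zeta> - a)"
  defines "z \<equiv> of_real (1 - h) * \<zeta>"
  shows "Re (\<zeta> * (of_real (1 - (norm a)\<^sup>2) / ((z - a) * (1 - cnj a * z)))) \<ge>
     64/81 * ((1 - (norm a)\<^sup>2) / (norm (\<zeta> - a))\<^sup>2)"
proof -
  define E where "E = \<zeta> - a"
  have E: "E \<noteq> 0" using assms by (auto simp: E_def)
  have \<zeta>: "\<zeta> \<noteq> 0" "cnj \<zeta> * \<zeta> = 1"
    using assms(1) cnj_mult_self_circle by auto
  define u v where "u = - of_real h * \<zeta> / E" and "v = of_real h * cnj a / cnj E"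
  have nu: "norm u \<le> 1/8"
    using assms E by (simp add: u_def E_def norm_mult norm_divide field_simps)
  have "norm v = norm a * (h / norm E)"
    using assms by (simp add: v_def norm_mult norm_divide)
  also have "\<dots> \<le> 1 * (1/8)"
    using assms E by (intro mult_mono) (auto simp: E_def field_simps)
  finally have nv: "norm v \<le> 1/8" by simp
  have "norm ((1 + u) * (1 + v) - 1) = norm (u + v + u * v)"
    by (simp add: algebra_simps)
  also have "\<dots> \<le> norm u + norm v + norm u * norm v"
    by (metis norm_mult norm_triangle_mono norm_triangle_ineq order_refl)
  also have "\<dots> \<le> 1/8 + 1/8 + 1/8 * (1/8)"
    using nu nv by (intro add_mono mult_mono) auto
  finally have q: "Re (1 / ((1 + u) * (1 + v))) \<ge> 64/81"
    using Re_inverse_ge[of "(1 + u) * (1 + v)" "17/64"] by simp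
  have A: "z - a = E * (1 + u)"
    using E by (simp add: z_def u_def E_def field_simps)
  have "1 - cnj a * z = \<zeta> * (cnj E + of_real h * cnj a)"
    using \<zeta>(2) by (simp add: z_def E_def algebra_simps)
  then have B: "1 - cnj a * z = \<zeta> * (cnj E * (1 + v))"
    using E by (simp add: v_def distrib_left)
  have "\<zeta> * (of_real (1 - (norm a)\<^sup>2) / ((z - a) * (1 - cnj a * z))) =
      of_real (1 - (norm a)\<^sup>2) / ((E * cnj E) * ((1 + u) * (1 + v)))"
    unfolding A B using \<zeta>(1) by (simp add: mult_ac)
  also have "E * cnj E = of_real ((norm E)\<^sup>2)"
    by (rule complex_norm_square[symmetric])
  also have "of_real (1 - (norm a)\<^sup>2) / (of_real ((norm E)\<^sup>2) * ((1 + u) * (1 + v))) =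
      of_real ((1 - (norm a)\<^sup>2) / (norm E)\<^sup>2) * (1 / ((1 + u) * (1 + v)))"
    by simp
  finally have "Re (\<zeta> * (of_real (1 - (norm a)\<^sup>2) / ((z - a) * (1 - cnj a * z)))) =
      (1 - (norm a)\<^sup>2) / (norm E)\<^sup>2 * Re (1 / ((1 + u) * (1 + v)))"
    by (metis Re_complex_of_real Im_complex_of_real diff_zero mult_zero_left times_complex.sel(1))
  also have "\<dots> \<ge> (1 - (norm a)\<^sup>2) / (norm E)\<^sup>2 * (64/81)"
    using q assms(2) by (intro mult_left_mono) (auto simp: power_le_one)
  finally show ?thesis by (simp add: E_def mult.commute)
qed

lemma one_minus_norm_blaschke_factor_sq_near_circle:
  fixes a \<zeta> :: complex and h :: real
  assumes "norm \<zeta> = 1" "norm a < 1" "0 \<le> h" "h \<le> 1" "8 * h \<le> norm (\<zeta> - a)"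
  defines "z \<equiv> of_real (1 - h) * \<zeta>"
  shows "1 - (norm (blaschke_factor a z))\<^sup>2 \<le>
     64/49 * (h * (2 - h)) * ((1 - (norm a)\<^sup>2) / (norm (\<zeta> - a))\<^sup>2)"
proof -
  have pos: "norm (\<zeta> - a) > 0" using assms by auto
  have nz: "norm z = 1 - h" using assms by (simp add: z_def norm_mult del: of_real_diff)
  have "1 - cnj a * \<zeta> = (1 - cnj a * z) + - (of_real h * cnj a * \<zeta>)"
    by (simp add: z_def algebra_simps)
  then have "norm (1 - cnj a * \<zeta>) \<le> norm (1 - cnj a * z) + norm (- (of_real h * cnj a * \<zeta>))"
    by (metis norm_triangle_ineq)
  also have "norm (- (of_real h * cnj a * \<zeta>)) \<le> h"
    using assms by (simp add: norm_mult mult_left_le)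
  finally have D: "7/8 * norm (\<zeta> - a) \<le> norm (1 - cnj a * z)"
    using norm_one_minus_cnj_mult[OF assms(1), of a] assms(5) by linarith
  then have nz': "1 - cnj a * z \<noteq> 0" using pos by auto
  have "1 - (norm (blaschke_factor a z))\<^sup>2 =
      (1 - (norm a)\<^sup>2) * (h * (2 - h)) / (norm (1 - cnj a * z))\<^sup>2"
    unfolding one_minus_norm_blaschke_factor_sq[OF nz'] nz
    by (simp add: power2_eq_square algebra_simps)
  also have "\<dots> \<le> (1 - (norm a)\<^sup>2) * (h * (2 - h)) / (7/8 * norm (\<zeta> - a))\<^sup>2"
    using assms(2-4) D pos nz'
    by (intro divide_left_mono power_mono) (auto intro!: mult_nonneg_nonneg mult_pos_pos simp: power_le_one)
  also have "\<dots> = 64/49 * (h * (2 - h)) * ((1 - (norm a)\<^sup>2) / (norm (\<zeta> - a))\<^sup>2)"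
    by (simp add: power_mult_distrib power2_eq_square)
  finally show ?thesis .
qed

section \<open>Derivatives at boundary points\<close>

text \<open>
  A function that is itself holomorphic around \<open>\<zeta>\<close> is one admissible extension; any other one agrees
  with it near \<open>\<zeta>\<close>, because every disc around \<open>\<zeta>\<close> meets the unit disc in a nonempty open set.
\<close>

lemma boundary_deriv_eq_deriv:
  assumes "norm \<zeta> = 1" "r > 0" "f holomorphic_on ball \<zeta> r"
  shows "boundary_deriv f \<zeta> = deriv f \<zeta>"
  unfolding boundary_deriv_def
proof (rule the_equality)
  show "\<exists>F U. open U \<and> \<zeta> \<in> U \<and> F holomorphic_on U \<and>
      (\<forall>w\<in>U \<inter> ball 0 1. F w = f w) \<and> deriv f \<zeta> = deriv F \<zeta>"
    using assms by (intro exI[of _ f] exI[of _ "ball \<zeta> r"]) auto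
next
  fix d
  assume "\<exists>F U. open U \<and> \<zeta> \<in> U \<and> F holomorphic_on U \<and>
      (\<forall>w\<in>U \<inter> ball 0 1. F w = f w) \<and> d = deriv F \<zeta>"
  then obtain F U where FU: "open U" "\<zeta> \<in> U" "F holomorphic_on U"
      "\<And>w. w \<in> U \<Longrightarrow> w \<in> ball 0 1 \<Longrightarrow> F w = f w" "d = deriv F \<zeta>"
    by blast
  obtain s where s: "s > 0" "ball \<zeta> s \<subseteq> U \<inter> ball \<zeta> r"
    using FU assms(2) by (meson IntI centre_in_ball open_Int open_ball openE)
  have "\<zeta> \<in> closure (ball 0 1)"
    using assms(1) by (simp add: closure_ball)
  then obtain w where w: "w \<in> ball 0 1" "dist w \<zeta> < s"
    using s(1) closure_approachable by blast
  have eq: "F z = f z" if "z \<in> ball \<zeta> s" for z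
  proof (rule analytic_continuation_open[of "ball \<zeta> s \<inter> ball 0 1" "ball \<zeta> s" F f])
    show "ball \<zeta> s \<inter> ball 0 1 \<noteq> {}"
      using w by (auto simp: dist_commute)
    show "F holomorphic_on ball \<zeta> s" "f holomorphic_on ball \<zeta> s"
      using FU(3) assms(3) s(2) by (auto intro: holomorphic_on_subset)
  qed (use FU(4) s(2) that in auto)
  have "eventually (\<lambda>z. F z = f z) (nhds \<zeta>)"
    unfolding eventually_nhds using eq s(1) by (intro exI[of _ "ball \<zeta> s"]) simp
  then show "d = deriv f \<zeta>"
    unfolding FU(5) by (rule deriv_cong_ev) simp
qed

section \<open>The product near a boundary point\<close>

lemma prod_one_minus_ge:
  fixes x :: "nat \<Rightarrow> real"
  assumes "\<And>i. 0 \<le> x i" "\<And>i. x i \<le> 1"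
  shows "1 - (\<Sum>i<n. x i) \<le> (\<Prod>i<n. 1 - x i)"
proof (induction n)
  case (Suc n)
  have "(\<Prod>i<n. 1 - x i) \<le> 1" 
    using assms by (intro prod_le_1) auto
  then have "(\<Prod>i<n. 1 - x i) * x n \<le> x n"
    using assms by (metis mult.commute mult_left_le)
  with Suc show ?case by (simp add: algebra_simps)
qed auto

text \<open>
  The Blaschke product as an ordinary infinite product over the natural numbers: indices beyond
  the length of the zero sequence contribute the factor \<open>1\<close>.
\<close>

definition padded_factor :: "enat \<Rightarrow> (nat \<Rightarrow> complex) \<Rightarrow> nat \<Rightarrow> complex \<Rightarrow> complex" where
  "padded_factor N a j z = (if j \<in> blaschke_index N then blaschke_factor (a j) z else 1)"

text \<open>
  The quantity \<open>(1 - |a\<^sub>j|\<^sup>2) / |\<zeta> - a\<^sub>j|\<^sup>2\<close>, which is the modulus of the derivative of the \<open>j\<close>-th factor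
  at the point \<open>\<zeta>\<close> of the unit circle; it is \<open>0\<close> beyond the length of the sequence.
\<close>

definition boundary_weight :: "enat \<Rightarrow> (nat \<Rightarrow> complex) \<Rightarrow> complex \<Rightarrow> nat \<Rightarrow> real" where
  "boundary_weight N a \<zeta> j =
     (if j \<in> blaschke_index N then (1 - (norm (a j))\<^sup>2) / (norm (\<zeta> - a j))\<^sup>2 else 0)"

lemma blaschke_product_eq_prodinf:
  "blaschke_product N a z = (\<Prod>j. padded_factor N a j z)"
  by (simp add: blaschke_product_def padded_factor_def)

text \<open>
  A point \<open>\<zeta>\<close> of the unit circle at distance at least \<open>d > 0\<close> from the zeros. The radius \<open>d / 2\<close> is
  small enough that on \<open>cball \<zeta> (d / 2)\<close> no factor has a zero or a pole.
\<close>

locale blaschke_boundary_point =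
  fixes N :: enat and a :: "nat \<Rightarrow> complex" and \<zeta> :: complex and d :: real
  assumes seq: "blaschke_sequence N a"
    and circle: "norm \<zeta> = 1"
    and d_pos: "d > 0"
    and d_le: "\<And>j. j \<in> blaschke_index N \<Longrightarrow> d \<le> norm (\<zeta> - a j)"
begin

lemma norm_zero_less: "j \<in> blaschke_index N \<Longrightarrow> norm (a j) < 1"
  using seq by (auto simp: blaschke_sequence_def)

lemma denominator_ge:
  assumes "j \<in> blaschke_index N" "z \<in> cball \<zeta> (d / 2)"
  shows "d / 2 \<le> norm (1 - cnj (a j) * z)"
proof -
  have "norm (cnj (a j) * (\<zeta> - z)) \<le> 1 * (d / 2)"
    unfolding norm_mult using assms norm_zero_less[OF assms(1)]
    by (intro mult_mono) (auto simp: dist_norm)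
  moreover have "1 - cnj (a j) * \<zeta> = (1 - cnj (a j) * z) - cnj (a j) * (\<zeta> - z)"
    by (simp add: algebra_simps)
  then have "norm (1 - cnj (a j) * \<zeta>) \<le>
      norm (1 - cnj (a j) * z) + norm (cnj (a j) * (\<zeta> - z))"
    by (metis norm_triangle_ineq4)
  ultimately show ?thesis
    using d_le[OF assms(1)] norm_one_minus_cnj_mult[OF circle, of "a j"] by linarith
qed

lemma denominator_nonzero:
  "j \<in> blaschke_index N \<Longrightarrow> z \<in> cball \<zeta> (d / 2) \<Longrightarrow> 1 - cnj (a j) * z \<noteq> 0"
  using denominator_ge[of j z] d_pos by auto

lemma not_zero_near:
  assumes "j \<in> blaschke_index N" "z \<in> cball \<zeta> (d / 2)"
  shows "z \<noteq> a j"
  using d_le[OF assms(1)] assms(2) d_pos by (auto simp: dist_norm)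

lemma holomorphic_padded_factor: "padded_factor N a j holomorphic_on cball \<zeta> (d / 2)"
proof (cases "j \<in> blaschke_index N")
  case True
  then have "padded_factor N a j = blaschke_factor (a j)"
    by (auto simp: padded_factor_def)
  then show ?thesis using denominator_nonzero True 
    by (auto intro: holomorphic_on_blaschke_factor)
next
  case False
  then have "padded_factor N a j = (\<lambda>_. 1)"
    by (auto simp: padded_factor_def)
  then show ?thesis by simp
qed

lemma padded_factor_nonzero: "z \<in> cball \<zeta> (d / 2) \<Longrightarrow> padded_factor N a j z \<noteq> 0"
  using denominator_nonzero not_zero_near by (auto simp: padded_factor_def blaschke_factor_eq_0_iff)

lemma logderiv_padded_factor:
  assumes "z \<in> cball \<zeta> (d / 2)"
  shows "deriv (padded_factor N a j) z / padded_factor N a j z =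
    (if j \<in> blaschke_index N
     then of_real (1 - (norm (a j))\<^sup>2) / ((z - a j) * (1 - cnj (a j) * z)) else 0)"
proof (cases "j \<in> blaschke_index N")
  case True
  then have "padded_factor N a j = blaschke_factor (a j)"
    by (auto simp: padded_factor_def)
  then show ?thesis
    using True logderiv_blaschke_factor[OF denominator_nonzero not_zero_near] assms by simp
next
  case False
  then have "padded_factor N a j = (\<lambda>_. 1)"
    by (auto simp: padded_factor_def)
  then show ?thesis using False by simp
qed

text \<open>The majorant for the Weierstrass test comes from the Blaschke condition.\<close>

lemma padded_factor_majorant:
  obtains M :: "nat \<Rightarrow> real" where "summable M"
    "\<And>j z. z \<in> cball \<zeta> (d / 2) \<Longrightarrow> norm (padded_factor N a j z - 1) \<le> M j"
proof
  define t where "t j = (if j \<in> blaschke_index N then 1 - norm (a j) else 0)" for j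
  have "(\<lambda>j. 1 - norm (a j)) summable_on blaschke_index N"
    using seq by (simp add: blaschke_sequence_def)
  also have "?this \<longleftrightarrow> t summable_on UNIV"
    by (intro summable_on_cong_neutral) (auto simp: t_def)
  finally have "summable t" by (rule summable_on_imp_summable)
  then show "summable (\<lambda>j. t j * ((2 + d / 2) / (d / 2)))" by (rule summable_mult2)
  fix j z assume z: "z \<in> cball \<zeta> (d / 2)"
  have nz: "norm z \<le> 1 + d / 2"
    using z circle norm_triangle_ineq2[of z \<zeta>] by (auto simp: dist_norm norm_minus_commute)
  show "norm (padded_factor N a j z - 1) \<le> t j * ((2 + d / 2) / (d / 2))"
  proof (cases "j \<in> blaschke_index N")
    case True
    have "norm (blaschke_factor (a j) z - 1) \<le> (1 - norm (a j)) * (1 + norm z) / (d / 2)"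
      using True z d_pos denominator_ge norm_zero_less
      by (intro norm_blaschke_factor_minus_1_le) auto
    also have "\<dots> \<le> (1 - norm (a j)) * (2 + d / 2) / (d / 2)"
      using nz d_pos norm_zero_less[OF True] by (intro divide_right_mono mult_left_mono) auto
    finally show ?thesis
      unfolding padded_factor_def t_def times_divide_eq_right using True by simp
  qed (simp add: padded_factor_def t_def)
qed

lemma abs_convergent_prod_padded_factor:
  assumes "z \<in> cball \<zeta> (d / 2)"
  shows "abs_convergent_prod (\<lambda>j. padded_factor N a j z)"
proof -
  obtain M where M: "summable M"
    "\<And>j z. z \<in> cball \<zeta> (d / 2) \<Longrightarrow> norm (padded_factor N a j z - 1) \<le> M j"
    using padded_factor_majorant by blast
  have "summable (\<lambda>j. norm (padded_factor N a j z - 1))"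
    using M(2)[OF assms] by (intro summable_comparison_test'[OF M(1)]) auto
  then show ?thesis by (rule summable_imp_abs_convergent_prod)
qed

lemma partial_products_tendsto:
  assumes "z \<in> cball \<zeta> (d / 2)"
  shows "(\<lambda>n. \<Prod>j<n. padded_factor N a j z) \<longlonglongrightarrow> blaschke_product N a z"
proof -
  have "(\<lambda>n. \<Prod>j\<le>n. padded_factor N a j z) \<longlonglongrightarrow> blaschke_product N a z"
    unfolding blaschke_product_eq_prodinf using assms
    by (intro convergent_prod_LIMSEQ abs_convergent_prod_imp_convergent_prod
        abs_convergent_prod_padded_factor)
  then show ?thesis
    by (subst (asm) lessThan_Suc_atMost [symmetric]) (rule LIMSEQ_imp_Suc)
qed

lemma uniform_limit_partial_products:
  "uniform_limit (cball \<zeta> (d / 2)) (\<lambda>n z. \<Prod>j<n. padded_factor N a j z)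
     (blaschke_product N a) sequentially"
proof -
  obtain M where M: "summable M"
    "\<And>j z. z \<in> cball \<zeta> (d / 2) \<Longrightarrow> norm (padded_factor N a j z - 1) \<le> M j"
    using padded_factor_majorant by blast
  have "uniformly_convergent_on (cball \<zeta> (d / 2)) (\<lambda>n z. \<Sum>j<n. norm (padded_factor N a j z - 1))"
    using M by (intro Weierstrass_m_test'[of _ _ M]) auto
  then have "uniformly_convergent_on (cball \<zeta> (d / 2)) (\<lambda>n z. \<Prod>j<n. padded_factor N a j z)"
    by (intro uniformly_convergent_on_prod' holomorphic_on_imp_continuous_on
        holomorphic_padded_factor) auto
  then obtain P where P: "uniform_limit (cball \<zeta> (d / 2))
      (\<lambda>n z. \<Prod>j<n. padded_factor N a j z) P sequentially"
    by (auto simp: uniformly_convergent_on_def)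
  have "P z = blaschke_product N a z" if "z \<in> cball \<zeta> (d / 2)" for z
    using tendsto_uniform_limitI[OF P that] partial_products_tendsto[OF that]
    by (rule LIMSEQ_unique)
  then show ?thesis
    using P uniform_limit_cong'[of "cball \<zeta> (d / 2)"] by (metis (no_types, lifting))
qed

lemma holomorphic_blaschke_product: "blaschke_product N a holomorphic_on ball \<zeta> (d / 2)"
proof (rule holomorphic_uniform_sequence)
  show "(\<lambda>z. \<Prod>j<n. padded_factor N a j z) holomorphic_on ball \<zeta> (d / 2)" for n
    by (intro holomorphic_intros holomorphic_on_subset[OF holomorphic_padded_factor]) auto
  show "\<exists>e>0. cball z e \<subseteq> ball \<zeta> (d / 2) \<and> uniform_limit (cball z e)
      (\<lambda>n z. \<Prod>j<n. padded_factor N a j z) (blaschke_product N a) sequentially"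
    if z: "z \<in> ball \<zeta> (d / 2)" for z
  proof -
    obtain e where e: "e > 0" "cball z e \<subseteq> ball \<zeta> (d / 2)"
      using z open_contains_cball_eq[OF open_ball] by blast
    have "cball z e \<subseteq> cball \<zeta> (d / 2)"
      using e(2) ball_subset_cball by (rule subset_trans)
    then have "uniform_limit (cball z e)
        (\<lambda>n z. \<Prod>j<n. padded_factor N a j z) (blaschke_product N a) sequentially"
      by (rule uniform_limit_on_subset[OF uniform_limit_partial_products])
    with e show ?thesis by auto
  qed
qed simp

lemma blaschke_product_nonzero:
  "z \<in> cball \<zeta> (d / 2) \<Longrightarrow> blaschke_product N a z \<noteq> 0"
  unfolding blaschke_product_eq_prodinf
  by (intro prodinf_nonzero abs_convergent_prod_imp_convergent_prod
      abs_convergent_prod_padded_factor padded_factor_nonzero)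

lemma logderiv_blaschke_product_sums:
  assumes "z \<in> ball \<zeta> (d / 2)"
  shows "(\<lambda>j. deriv (padded_factor N a j) z / padded_factor N a j z) sums
    (deriv (blaschke_product N a) z / blaschke_product N a z)"
proof (rule logderiv_prodinf_complex_uniform_limit)
  show "uniform_limit (ball \<zeta> (d / 2)) (\<lambda>n z. \<Prod>j<n. padded_factor N a j z)
     (blaschke_product N a) sequentially"
    by (rule uniform_limit_on_subset[OF uniform_limit_partial_products]) auto
  show "padded_factor N a j holomorphic_on ball \<zeta> (d / 2)" for j
    by (rule holomorphic_on_subset[OF holomorphic_padded_factor]) auto
  show "blaschke_product N a z \<noteq> 0"
    using assms by (intro blaschke_product_nonzero) auto
qed (use assms in auto)

lemma norm_blaschke_product_boundary: "norm (blaschke_product N a \<zeta>) = 1"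
proof -
  have z: "\<zeta> \<in> cball \<zeta> (d / 2)" using d_pos by simp
  have "norm (padded_factor N a j \<zeta>) = 1" for j
  proof (cases "j \<in> blaschke_index N")
    case True
    have "1 - (norm (blaschke_factor (a j) \<zeta>))\<^sup>2 = 0"
      using one_minus_norm_blaschke_factor_sq[OF denominator_nonzero[OF True z]] circle by simp
    then show ?thesis
      using True by (simp add: padded_factor_def power2_eq_1_iff)
        (metis norm_ge_zero not_one_le_zero neg_0_le_iff_le)
  qed (simp add: padded_factor_def)
  then have "(\<lambda>n. norm (\<Prod>j<n. padded_factor N a j \<zeta>)) = (\<lambda>n. 1)"
    by (simp add: prod_norm[symmetric])
  then show ?thesis
    using tendsto_norm[OF partial_products_tendsto[OF z]] LIMSEQ_unique by auto
qed

text \<open>The terms of the logarithmic derivative at \<open>\<zeta>\<close> all have the argument of \<open>1 / \<zeta>\<close>.\<close>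

lemma boundary_weight_sums:
  "boundary_weight N a \<zeta> sums norm (deriv (blaschke_product N a) \<zeta>)"
proof -
  have z: "\<zeta> \<in> ball \<zeta> (d / 2)" "\<zeta> \<in> cball \<zeta> (d / 2)" using d_pos by auto
  define L where "L = \<zeta> * (deriv (blaschke_product N a) \<zeta> / blaschke_product N a \<zeta>)"
  have \<zeta>: "\<zeta> \<noteq> 0" "cnj \<zeta> * \<zeta> = 1"
    using circle cnj_mult_self_circle by auto
  have "\<zeta> * (deriv (padded_factor N a j) \<zeta> / padded_factor N a j \<zeta>) =
      of_real (boundary_weight N a \<zeta> j)" for j
  proof (cases "j \<in> blaschke_index N")
    case True
    have "1 - cnj (a j) * \<zeta> = \<zeta> * cnj (\<zeta> - a j)"
      using \<zeta>(2) by (simp add: algebra_simps)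
    then have "(\<zeta> - a j) * (1 - cnj (a j) * \<zeta>) = \<zeta> * ((\<zeta> - a j) * cnj (\<zeta> - a j))"
      by (simp only: mult_ac)
    also have "(\<zeta> - a j) * cnj (\<zeta> - a j) = of_real ((norm (\<zeta> - a j))\<^sup>2)"
      by (simp only: complex_norm_square)
    finally show ?thesis
      using True \<zeta>(1) by (simp add: logderiv_padded_factor[OF z(2)] boundary_weight_def)
  qed (simp add: logderiv_padded_factor[OF z(2)] boundary_weight_def)
  then have s: "(\<lambda>j. complex_of_real (boundary_weight N a \<zeta> j)) sums L"
    using sums_mult[OF logderiv_blaschke_product_sums[OF z(1)], of \<zeta>] by (simp add: L_def)
  then have R: "boundary_weight N a \<zeta> sums Re L" and I: "(\<lambda>j. 0::real) sums Im L"
    using sums_Re[OF s] sums_Im[OF s] by auto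
  have "Im L = 0" using I sums_unique2 sums_zero by blast
  moreover have "boundary_weight N a \<zeta> j \<ge> 0" for j
    using norm_zero_less[of j] by (auto simp: boundary_weight_def power_le_one)
  then have "Re L \<ge> 0" using sums_le[OF _ sums_zero R] by auto
  ultimately have "Re L = norm L" by (simp add: cmod_def)
  also have "\<dots> = norm (deriv (blaschke_product N a) \<zeta>)"
    by (simp add: L_def norm_mult norm_divide circle norm_blaschke_product_boundary)
  finally show ?thesis using R by simp
qed

text \<open>The two estimates at the radial point \<open>(1 - h) \<zeta>\<close>, whose distance from \<open>\<zeta>\<close> is \<open>h\<close>.\<close>

context
  fixes h :: real
  assumes h: "0 \<le> h" "8 * h \<le> d" "h \<le> 1"
begin

lemma radial_point_near: "of_real (1 - h) * \<zeta> \<in> ball \<zeta> (d / 2)"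
proof -
  have "\<zeta> - of_real (1 - h) * \<zeta> = of_real h * \<zeta>"
    by (simp add: algebra_simps)
  then have "dist \<zeta> (of_real (1 - h) * \<zeta>) = h"
    using circle h by (simp add: dist_norm norm_mult)
  then show ?thesis using h d_pos by simp
qed

lemma norm_logderiv_radial_ge:
  defines "z \<equiv> of_real (1 - h) * \<zeta>"
  shows "norm (deriv (blaschke_product N a) z / blaschke_product N a z) \<ge>
    64/81 * norm (deriv (blaschke_product N a) \<zeta>)"
proof -
  have z: "z \<in> ball \<zeta> (d / 2)" "z \<in> cball \<zeta> (d / 2)"
    using radial_point_near by (auto simp: z_def)
  define L where "L = deriv (blaschke_product N a) z / blaschke_product N a z"
  have "64/81 * boundary_weight N a \<zeta> j \<le>
      Re (\<zeta> * (deriv (padded_factor N a j) z / padded_factor N a j z))" for j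
  proof (cases "j \<in> blaschke_index N")
    case True
    then show ?thesis
      using Re_logderiv_blaschke_factor_near_circle[OF circle norm_zero_less[OF True] h(1)]
        d_le[OF True] h(2)
        logderiv_padded_factor[OF z(2), of j]
      by (simp add: z_def boundary_weight_def)
  qed (simp add: logderiv_padded_factor[OF z(2)] boundary_weight_def)
  moreover have "(\<lambda>j. 64/81 * boundary_weight N a \<zeta> j) sums
      (64/81 * norm (deriv (blaschke_product N a) \<zeta>))"
    by (intro sums_mult boundary_weight_sums)
  moreover have "(\<lambda>j. Re (\<zeta> * (deriv (padded_factor N a j) z / padded_factor N a j z))) sums Re (\<zeta> * L)"
    unfolding L_def by (intro sums_Re sums_mult logderiv_blaschke_product_sums z)
  ultimately have "64/81 * norm (deriv (blaschke_product N a) \<zeta>) \<le> Re (\<zeta> * L)"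
    by (rule sums_le)
  also have "\<dots> \<le> norm L"
    using complex_Re_le_cmod[of "\<zeta> * L"] circle by (simp add: norm_mult)
  finally show ?thesis by (simp add: L_def)
qed

lemma norm_blaschke_product_radial_ge:
  defines "z \<equiv> of_real (1 - h) * \<zeta>"
  shows "(norm (blaschke_product N a z))\<^sup>2 \<ge>
    1 - 64/49 * (h * (2 - h)) * norm (deriv (blaschke_product N a) \<zeta>)"
proof -
  have z: "z \<in> cball \<zeta> (d / 2)"
    using radial_point_near by (auto simp: z_def)
  have nz: "norm z \<le> 1" using h circle by (simp add: z_def norm_mult del: of_real_diff)
  define x where "x j = 1 - (norm (padded_factor N a j z))\<^sup>2" for j
  have x0: "0 \<le> x j" for j
  proof (cases "j \<in> blaschke_index N")
    case True
    then show ?thesis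
      using one_minus_norm_blaschke_factor_sq[OF denominator_nonzero[OF True z]] nz
        norm_zero_less[OF True]
      by (simp add: x_def padded_factor_def power_le_one)
  qed (simp add: x_def padded_factor_def)
  have x1: "x j \<le> 1" for j by (simp add: x_def)
  have xw: "x j \<le> 64/49 * (h * (2 - h)) * boundary_weight N a \<zeta> j" for j
  proof (cases "j \<in> blaschke_index N")
    case True
    then show ?thesis
      using one_minus_norm_blaschke_factor_sq_near_circle[OF circle norm_zero_less[OF True] h(1,3)]
        d_le[OF True] h(2)
      unfolding x_def padded_factor_def boundary_weight_def z_def
      by (simp only: if_True)
  qed (simp add: x_def padded_factor_def boundary_weight_def)
  have "1 - (\<Sum>j<n. 64/49 * (h * (2 - h)) * boundary_weight N a \<zeta> j) \<le>
      (norm (\<Prod>j<n. padded_factor N a j z))\<^sup>2" for n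
  proof -
    have "1 - (\<Sum>j<n. 64/49 * (h * (2 - h)) * boundary_weight N a \<zeta> j) \<le> 1 - (\<Sum>j<n. x j)"
      by (intro diff_left_mono sum_mono xw)
    also have "\<dots> \<le> (\<Prod>j<n. 1 - x j)"
      using x0 x1 by (rule prod_one_minus_ge)
    finally show ?thesis
      by (simp add: x_def prod_power_distrib prod_norm[symmetric])
  qed
  moreover have "(\<lambda>n. 1 - (\<Sum>j<n. 64/49 * (h * (2 - h)) * boundary_weight N a \<zeta> j)) \<longlonglongrightarrow>
      1 - 64/49 * (h * (2 - h)) * norm (deriv (blaschke_product N a) \<zeta>)"
    using sums_mult[OF boundary_weight_sums] unfolding sums_def
    by (intro tendsto_diff tendsto_const)
  moreover have "(\<lambda>n. (norm (\<Prod>j<n. padded_factor N a j z))\<^sup>2) \<longlonglongrightarrow>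
      (norm (blaschke_product N a z))\<^sup>2"
    by (intro tendsto_power tendsto_norm partial_products_tendsto z)
  ultimately show ?thesis
    by (intro LIMSEQ_le) auto
qed

end

end

section \<open>The lower bound for the hyperbolic derivative\<close>

theorem theorem4:
  fixes N :: enat and a :: "nat \<Rightarrow> complex" and \<zeta> z0 :: complex and \<delta> :: real
  assumes "blaschke_sequence N a"
    and "norm \<zeta> = 1"
    and "infdist \<zeta> (a ` blaschke_index N) > 0"
    and "0 < \<delta>" and "\<delta> \<le> 1"
    and "norm (boundary_deriv (blaschke_product N a) \<zeta>) * infdist \<zeta> (a ` blaschke_index N) \<ge> \<delta>"
    and "z0 = complex_of_real (1 - \<delta> / (8 * norm (boundary_deriv (blaschke_product N a) \<zeta>))) * \<zeta>"
  shows "norm (deriv (blaschke_product N a) z0) * (1 - (norm z0)\<^sup>2) \<ge> 0.07 * \<delta>"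
proof -
  define d where "d = infdist \<zeta> (a ` blaschke_index N)"
  have d_le: "d \<le> norm (\<zeta> - a j)" if "j \<in> blaschke_index N" for j
    using that by (auto simp: d_def dist_norm intro!: infdist_le2)
  interpret blaschke_boundary_point N a \<zeta> d
    using assms d_le by unfold_locales (auto simp: d_def)
  define B where "B = blaschke_product N a"
  define M where "M = norm (deriv B \<zeta>)"
  define h where "h = \<delta> / (8 * M)"
  have bd: "norm (boundary_deriv B \<zeta>) = M"
    unfolding M_def B_def
    using boundary_deriv_eq_deriv[OF circle _ holomorphic_blaschke_product] d_pos by simp
  have Md: "\<delta> \<le> M * d" and z0: "z0 = of_real (1 - h) * \<zeta>"
    using assms(6,7) bd by (simp_all add: B_def d_def h_def)
  have M: "M > 0"
    using Md assms(4) d_pos by (metis less_le_trans zero_less_mult_pos2)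
  have "d \<le> 2"
  proof -
    have "0 \<in> blaschke_index N"
      using assms(1) by (simp add: blaschke_sequence_def blaschke_index_def flip: zero_enat_def)
    then show ?thesis
      using d_le[of 0] norm_zero_less[of 0] norm_triangle_ineq4[of \<zeta> "a 0"] circle by simp
  qed
  moreover have "8 * h \<le> d"
    using Md M by (simp add: h_def field_simps)
  moreover have "0 \<le> h"
    using M assms(4) by (simp add: h_def)
  ultimately have h: "0 \<le> h" "8 * h \<le> d" "h \<le> 1" "h \<le> 1/4" by auto
  have hM: "h * M = \<delta> / 8" using M by (simp add: h_def)
  have "h * (2 - h) * M = (\<delta> / 8) * (2 - h)" unfolding hM[symmetric] by simp
  also have "\<dots> \<le> (1 / 8) * 2" using h assms(4,5) by (intro mult_mono) auto
  finally have "(norm (B z0))\<^sup>2 \<ge> 1 - 64/49 * (1/4)"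
    using norm_blaschke_product_radial_ge[OF h(1-3)] by (simp add: B_def M_def z0)
  then have "(norm (B z0))\<^sup>2 \<ge> (4/5)\<^sup>2" by (simp add: power2_eq_square)
  then have Bz0: "norm (B z0) \<ge> 4/5" by (rule power2_le_imp_le) simp
  have "norm (deriv B z0) = norm (deriv B z0 / B z0) * norm (B z0)"
    using Bz0 by (auto simp: norm_divide)
  also have "\<dots> \<ge> (64/81 * M) * (4/5)"
    using norm_logderiv_radial_ge[OF h(1-3)] Bz0 M
    by (intro mult_mono) (auto simp: B_def M_def z0)
  finally have D: "norm (deriv B z0) \<ge> (64/81 * M) * (4/5)" .
  have "norm z0 = 1 - h"
    using h circle by (simp add: z0 norm_mult del: of_real_diff)
  then have "1 - (norm z0)\<^sup>2 = h * (2 - h)"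
    by (simp only:) (simp add: power2_eq_square algebra_simps)
  moreover have "h * (2 - h) \<ge> h * (7/4)"
    using h by (intro mult_left_mono) auto
  ultimately have "1 - (norm z0)\<^sup>2 \<ge> h * (7/4)" by simp
  then have "norm (deriv B z0) * (1 - (norm z0)\<^sup>2) \<ge> (64/81 * M) * (4/5) * (h * (7/4))"
    using D M h by (intro mult_mono) auto
  moreover have "(64/81 * M) * (4/5) * (h * (7/4)) = 64/81 * (4/5) * (7/4) * (\<delta> / 8)"
    unfolding hM[symmetric] by simp
  moreover have "\<dots> \<ge> 0.07 * \<delta>"
    using assms(4) by simp
  ultimately show ?thesis
    unfolding B_def by linarith
qed

end
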